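(* Let $X$ be a real or complex Banach space, let $A:\mathbb{N}\to\mathcal{B}(X)$ be a sequence, and consider the linear discrete-time system $x_{n+1}=A(n)x_n$ with associated operators $A_m^n$, $(m,n)\in\Delta$. The system is exponentially stable if and only if there exist constants $D\ge1$, $d>0$ and $c\ge0$ such that $$\sum_{m=n}^{\infty}e^{d(m-n)}\|A_m^n x\|\le D e^{cn}\|x\|\quad\text{for all }n\in\mathbb{N}\text{ and }x\in X.$$
   Context: $\mathbb{N}=\{0,1,2,\dots\}$. $\mathcal{B}(X)$ is the Banach algebra of bounded linear operators on $X$, and $I$ is the identity operator. $\Delta$ is the set of pairs $(m,n)$ of nonnegative integers with $m\ge n$. $T$ is the set of triples $(m,n,p)$ of nonnegative integers with $(m,n)\in\Delta$ and $(n,p)\in\Delta$. For $(m,n)\in\Delta$, $A_m^n=A(m)A(m-1)\cdots A(n+1)$ if $m\ge n+1$, and $A_m^n=I$ if $m=n$. An inequality bounding an infinite series of nonnegative terms includes the assertion that the series converges. The system is exponentially stable if there are constants $N\ge1$, $\alpha>0$ and $\beta\ge0$ such that $\|A_m^p x\|\le N e^{-\alpha(m-n)}e^{\beta n}\|A_n^p x\|$ for all $(m,n,p)\in T$ and $x\in X$. *)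

theory Defs
  imports "HOL-Analysis.Analysis"
begin

text \<open>
  The class \<^class>\<open>banach\<close> is that of real Banach spaces. A complex Banach space is an instance by
  restriction of scalars, with the same norm; its bounded complex-linear operators are then
  elements of the type of bounded linear operators used here, and all notions below involve only
  norms, composition and application of operators. So both scalar fields are covered.
\<close>

text \<open>
  \<open>evol A m n\<close> is $A_m^n = A(m) A(m-1) \cdots A(n+1)$ for $m > n$, and $I$ for $m = n$. The
  leftmost factor is $A(m)$ and $A(n)$ does not occur. For $m < n$ the value (again $I$) is
  irrelevant.
\<close>

primrec evol :: "(nat \<Rightarrow> 'a::banach \<Rightarrow>\<^sub>L 'a) \<Rightarrow> nat \<Rightarrow> nat \<Rightarrow> 'a \<Rightarrow>\<^sub>L 'a" where
  "evol A 0 n = id_blinfun"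
| "evol A (Suc m) n = (if n \<le> m then A (Suc m) o\<^sub>L evol A m n else id_blinfun)"

definition exponentially_stable :: "(nat \<Rightarrow> 'a::banach \<Rightarrow>\<^sub>L 'a) \<Rightarrow> bool" where
  "exponentially_stable A \<longleftrightarrow>
    (\<exists>N \<alpha> \<beta> :: real. N \<ge> 1 \<and> \<alpha> > 0 \<and> \<beta> \<ge> 0 \<and>
      (\<forall>m n p x. n \<le> m \<and> p \<le> n \<longrightarrow>
        norm (evol A m p x) \<le> N * exp (- \<alpha> * (real m - real n)) * exp (\<beta> * real n) * norm (evol A n p x)))"

end

theory Submission
  imports Defs
begin

text \<open>This is a Datko-type characterization. If the system is exponentially stable, the case
  \<open>p = n\<close> bounds the norm of \<open>evol A m n x\<close> by a multiple of
  exp(-\<alpha>(m-n)); a weight growing at a rate below \<alpha> still leaves a convergent geometric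
  series (\<open>has_sum_exp_from\<close>). Conversely, each term of a nonnegative series is at most
  its sum, which gives decay of \<open>evol A m n y\<close> for every vector y; the cocycle identity
  \<open>evol_comp\<close> carries this over to an arbitrary starting time p by choosing y =
  \<open>evol A n p x\<close>.\<close>

lemma evol_same [simp]: "evol A n n = id_blinfun"
  by (cases n) auto

text \<open>Induction on m upward from n: with p and n both at most m, each side gains the same left
  factor \<open>A (Suc m)\<close>, and the default branch of \<open>evol\<close> is never
  met.\<close>

lemma evol_comp:
  assumes "p \<le> n" "n \<le> m"
  shows "evol A m p = evol A m n o\<^sub>L evol A n p"
  using assms(2)
proof (induction m rule: dec_induct)
  case base
  show ?case by (rule blinfun_eqI) simp
next
  case (step m)
  then show ?case using assms(1) by (intro blinfun_eqI) simp
qed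

text \<open>A geometric series of ratio exp(-d), reindexed by m = n + k. Its value is independent of
  n, so a single constant D serves all starting times.\<close>

lemma has_sum_exp_from:
  fixes d :: real
  assumes "d > 0"
  shows "((\<lambda>m. exp (- d * (real m - real n))) has_sum 1 / (1 - exp (- d))) {n..}"
proof -
  have "(\<lambda>k. exp (- d) ^ k) sums (1 / (1 - exp (- d)))"
    using assms by (intro geometric_sums) simp
  then have "((\<lambda>k. exp (- d) ^ k) has_sum 1 / (1 - exp (- d))) UNIV"
    by (intro sums_nonneg_imp_has_sum) simp_all
  also have "(\<lambda>k. exp (- d) ^ k) = (\<lambda>m. exp (- d * (real m - real n))) \<circ> (+) n"
    by (rule ext) (simp flip: exp_of_nat_mult add: mult.commute)
  finally have "((\<lambda>m. exp (- d * (real m - real n))) has_sum 1 / (1 - exp (- d))) ((+) n ` UNIV)"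
    by (simp only: has_sum_reindex inj_on_add)
  also have "(+) n ` UNIV = {n..}"
    by (auto simp: image_iff le_iff_add)
  finally show ?thesis .
qed

theorem theorem7:
  fixes A :: "nat \<Rightarrow> 'a::banach \<Rightarrow>\<^sub>L 'a"
  shows "exponentially_stable A \<longleftrightarrow>
    (\<exists>D d c :: real. D \<ge> 1 \<and> d > 0 \<and> c \<ge> 0 \<and>
      (\<forall>n x.
        (\<lambda>m. exp (d * (real m - real n)) * norm (evol A m n x)) summable_on {n..} \<and>
        (\<Sum>\<^sub>\<infinity>m\<in>{n..}. exp (d * (real m - real n)) * norm (evol A m n x)) \<le> D * exp (c * real n) * norm x))"
    (is "_ \<longleftrightarrow> ?summable")
proof
  assume "exponentially_stable A"
  then obtain N \<alpha> \<beta> :: real where N: "N \<ge> 1" and \<alpha>: "\<alpha> > 0" and \<beta>: "\<beta> \<ge> 0"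
    and bound: "\<And>m n p x. n \<le> m \<Longrightarrow> p \<le> n \<Longrightarrow>
      norm (evol A m p x) \<le> N * exp (- \<alpha> * (real m - real n)) * exp (\<beta> * real n) * norm (evol A n p x)"
    unfolding exponentially_stable_def by (elim exE conjE) (rule that, assumption+, iprover)
  \<comment> \<open>Half of the decay rate absorbs the weight, the other half keeps the series
    convergent; any rate strictly between 0 and \<alpha> would do.\<close>
  define d where "d = \<alpha> / 2"
  define D where "D = N * (1 / (1 - exp (- d)))"
  have d: "d > 0" using \<alpha> by (simp add: d_def)
  \<comment> \<open>The sum of the geometric series is at least its first term 1, so D inherits the
    lower bound 1 from N.\<close>
  have "1 / (1 - exp (- d)) \<ge> 1" using d by simp
  then have "1 * 1 \<le> N * (1 / (1 - exp (- d)))"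
    using N by (intro mult_mono) linarith+
  then have D: "D \<ge> 1" by (simp add: D_def)
  have "(\<lambda>m. exp (d * (real m - real n)) * norm (evol A m n x)) summable_on {n..} \<and>
    (\<Sum>\<^sub>\<infinity>m\<in>{n..}. exp (d * (real m - real n)) * norm (evol A m n x)) \<le> D * exp (\<beta> * real n) * norm x"
    (is "?f summable_on _ \<and> _") for n x
  proof -
    let ?g = "\<lambda>m. N * exp (\<beta> * real n) * norm x * exp (- d * (real m - real n))"
    have g: "(?g has_sum D * exp (\<beta> * real n) * norm x) {n..}"
      using has_sum_cmult_right[OF has_sum_exp_from[OF d, of n], of "N * exp (\<beta> * real n) * norm x"]
      by (simp add: D_def mult_ac)
    have le: "?f m \<le> ?g m" if "m \<in> {n..}" for m
    proof -
      \<comment> \<open>Stability is used with \<open>p = n\<close>, where \<open>evol A n n\<close>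
        is the identity and the last factor becomes \<open>norm x\<close>.\<close>
      have "?f m \<le> exp (d * (real m - real n)) *
          (N * exp (- \<alpha> * (real m - real n)) * exp (\<beta> * real n) * norm x)"
        using bound[of n m n x] that by (intro mult_left_mono) simp_all
      also have "\<dots> = N * exp (\<beta> * real n) * norm x *
          (exp (d * (real m - real n)) * exp (- \<alpha> * (real m - real n)))"
        by (simp add: mult_ac)
      also have "exp (d * (real m - real n)) * exp (- \<alpha> * (real m - real n)) =
          exp (- d * (real m - real n))"
        unfolding exp_add[symmetric] by (simp add: d_def field_simps)
      finally show ?thesis .
    qed
    have f: "?f summable_on {n..}"
      using has_sum_imp_summable[OF g] le by (rule summable_on_comparison_test) simp_all
    have "infsum ?f {n..} \<le> D * exp (\<beta> * real n) * norm x"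
      using has_sum_infsum[OF f] g le by (rule has_sum_mono)
    with f show ?thesis ..
  qed
  with D d \<beta> show ?summable by (intro exI[of _ D] exI[of _ d] exI[of _ \<beta>]) simp
next
  assume ?summable
  then obtain D d c :: real where D: "D \<ge> 1" and d: "d > 0" and c: "c \<ge> 0"
    and summable: "\<And>n x. (\<lambda>m. exp (d * (real m - real n)) * norm (evol A m n x)) summable_on {n..}"
    and bound: "\<And>n x. (\<Sum>\<^sub>\<infinity>m\<in>{n..}. exp (d * (real m - real n)) * norm (evol A m n x))
      \<le> D * exp (c * real n) * norm x"
    by (elim exE conjE) (rule that, assumption+, iprover+)
  have "norm (evol A m p x) \<le> D * exp (- d * (real m - real n)) * exp (c * real n) * norm (evol A n p x)"
    if "n \<le> m" "p \<le> n" for m n p x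
  proof -
    \<comment> \<open>The state reached at time n serves as a new initial vector, so the series
      bound at n yields \<open>norm (evol A n p x)\<close> on the right.\<close>
    define y where "y = evol A n p x"
    have "exp (d * (real m - real n)) * norm (evol A m n y)
        \<le> (\<Sum>\<^sub>\<infinity>k\<in>{n..}. exp (d * (real k - real n)) * norm (evol A k n y))"
      \<comment> \<open>The term with index m is a partial sum over \<open>{m}\<close> of a summable
        nonnegative family.\<close>
      using finite_sum_le_infsum[OF summable[of n y], of "{m}"] that by simp
    also have "\<dots> \<le> D * exp (c * real n) * norm y"
      by (rule bound)
    finally have "norm (evol A m n y) \<le> D * exp (- d * (real m - real n)) * exp (c * real n) * norm y"
      by (simp add: exp_minus divide_simps mult_ac)
    then show ?thesis
      by (simp add: y_def evol_comp[OF that(2,1)])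
  qed
  with D d c show "exponentially_stable A"
    unfolding exponentially_stable_def by (intro exI[of _ D] exI[of _ d] exI[of _ c]) simp
qed

end
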